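(* Let $m\ge 1$ and $n$ be integers such that $n-m\ge 3$ is odd, and set $k=\frac{n-m-2}{2}$, $l=\frac m2$, and $\nu=k-\frac12$. Then for all $0\le\delta<1$ $$\psi\bigg(\frac{\delta}{\sqrt{1-\delta^2}}\bigg)=\sum_{j=0}^{\nu}\frac{\Gamma(k+l+1)}{\Gamma(k-j+1)\,\Gamma(l+j+1)}\,(1-\delta^2)^{k-j}\,\delta^{2(l+j)}+\Delta(\delta),$$ where the remainder has the integral representation $$\Delta(\delta)=\frac{2}{\sqrt{\pi}}\,\frac{\Gamma(n/2)}{\Gamma((n-1)/2)}\int_0^\delta\frac{t^{n-2}}{\sqrt{1-t^2}}\,dt$$ and satisfies $0\le\Delta(\delta)\le\delta^{n-1}$ for all $0\le\delta<1$.
   Context: For integers $1\le m<n$, the function $\psi$ (depending on $m$ and $n$) is defined for $\varepsilon\ge 0$ by $$\psi(\varepsilon)=\frac{2\,\Gamma(n/2)}{\Gamma(m/2)\,\Gamma((n-m)/2)}\int_0^{\varepsilon}\frac{t^{m-1}}{(1+t^2)^{n/2}}\,dt .$$ Here $\Gamma$ is the Gamma function. *)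

theory Defs
  imports "HOL-Analysis.Analysis"
begin

text \<open>Both functions are meant for \<open>1 \<le> m < n\<close>, \<open>\<epsilon> \<ge> 0\<close> and \<open>0 \<le> \<delta> < 1\<close>; there the
  integrands are continuous on the closed interval of integration (and, for \<open>n \<ge> 2\<close>, the natural
  number subtractions in the exponents are exact).\<close>

definition psi :: "nat \<Rightarrow> nat \<Rightarrow> real \<Rightarrow> real" where
  "psi m n \<epsilon> =
     2 * Gamma (real n / 2) / (Gamma (real m / 2) * Gamma ((real n - real m) / 2)) *
     integral {0..\<epsilon>} (\<lambda>t. t ^ (m - 1) / (1 + t\<^sup>2) powr (real n / 2))"

definition Delta :: "nat \<Rightarrow> real \<Rightarrow> real" where
  "Delta n \<delta> =
     2 / sqrt pi * (Gamma (real n / 2) / Gamma ((real n - 1) / 2)) *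
     integral {0..\<delta>} (\<lambda>t. t ^ (n - 2) / sqrt (1 - t\<^sup>2))"

end

theory Submission
  imports Defs
begin

text \<open>
  Up to the factor \<open>\<Gamma> (p + q + 1)\<close>, the function \<open>x \<mapsto> 2 (1 - x\<^sup>2)\<^sup>p x\<^bsup>2q-1\<^esup> / (\<Gamma> (p + 1) \<Gamma> q)\<close>
  is the density on \<open>(0, 1)\<close> of the square root of a Beta distributed variable with parameters
  \<open>q\<close> and \<open>p + 1\<close>. Both functions of the theorem are integrals over \<open>[0, \<delta>]\<close> of such densities
  with \<open>p + q + 1 = n / 2\<close>: the substitution \<open>t = x / \<surd>(1 - x\<^sup>2)\<close> turns \<open>\<psi>\<close> into the case
  \<open>p = k\<close>, \<open>q = l\<close> (\<open>psi_eq_density_integral\<close>), and \<open>\<Delta>\<close> is the case \<open>p = - 1 / 2\<close>,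
  \<open>q = (n - 1) / 2\<close> (\<open>Delta_eq_density_integral\<close>).

  The sum connects the two because of a telescoping identity. The derivative of
  \<open>(1 - x\<^sup>2)\<^sup>p x\<^bsup>2q\<^esup> / (\<Gamma> (p + 1) \<Gamma> (q + 1))\<close> is the density for \<open>(p, q)\<close> minus the density for
  \<open>(p - 1, q + 1)\<close> (\<open>has_derivative_boundary\<close>), so each integration moves one unit from \<open>p\<close> to
  \<open>q\<close> at the price of one boundary term. As \<open>n - m\<close> is odd, \<open>k\<close> is a half-integer, and after
  \<open>\<nu> + 1\<close> such steps the first parameter has dropped from \<open>k\<close> to exactly \<open>- 1 / 2\<close>
  (\<open>density_integral_expansion\<close>).

  For the upper bound on \<open>\<Delta>\<close>, the substitution \<open>v = (t / \<delta>)\<^sup>2\<close> extracts the factor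
  \<open>\<delta>\<^bsup>n-1\<^esup>\<close> and leaves an integral over \<open>[0, 1]\<close> with the factor \<open>1 / \<surd>(1 - \<delta>\<^sup>2 v)\<close>; bounding this
  by \<open>1 / \<surd>(1 - v)\<close> gives a complete Beta integral, whose value cancels the Gamma quotient in
  front (\<open>Delta_le_power\<close>).
\<close>

section \<open>Telescoping incomplete Beta integrals\<close>

text \<open>
  The normalising factor \<open>\<Gamma> (p + q + 1)\<close> is left out because \<open>p + q\<close> does not change along the
  telescoping sum.
\<close>
definition sqrt_beta_density :: "real \<Rightarrow> real \<Rightarrow> real \<Rightarrow> real" where
  "sqrt_beta_density p q x = 2 * (1 - x\<^sup>2) powr p * x powr (2 * q - 1) / (Gamma (p + 1) * Gamma q)"

definition boundary :: "real \<Rightarrow> real \<Rightarrow> real \<Rightarrow> real" where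
  "boundary p q x = (1 - x\<^sup>2) powr p * x powr (2 * q) / (Gamma (p + 1) * Gamma (q + 1))"

lemma one_minus_square_pos:
  fixes x :: real
  assumes "0 \<le> x" "x < 1"
  shows "0 < 1 - x\<^sup>2"
  using assms by (simp add: abs_square_less_1)

lemma continuous_on_boundary:
  assumes "0 < q" "\<delta> < 1"
  shows "continuous_on {0..\<delta>} (boundary p q)"
proof -
  have "Gamma (q + 1) > 0" using assms by simp
  moreover have "continuous_on {0..\<delta>} (\<lambda>x. (1 - x\<^sup>2) powr p)"
    using assms one_minus_square_pos by (intro continuous_intros continuous_on_powr') fastforce+
  moreover have "continuous_on {0..\<delta>} (\<lambda>x. x powr (2 * q))"
    using assms by (intro continuous_on_powr' continuous_intros) auto
  ultimately show ?thesis
    unfolding boundary_def by (cases "Gamma (p + 1) = 0") (auto intro!: continuous_intros)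
qed

lemma continuous_on_density:
  assumes "1 / 2 < q" "\<delta> < 1"
  shows "continuous_on {0..\<delta>} (sqrt_beta_density p q)"
proof -
  have "Gamma q > 0" using assms by simp
  moreover have "continuous_on {0..\<delta>} (\<lambda>x. (1 - x\<^sup>2) powr p)"
    using assms one_minus_square_pos by (intro continuous_intros continuous_on_powr') fastforce+
  moreover have "continuous_on {0..\<delta>} (\<lambda>x. x powr (2 * q - 1))"
    using assms by (intro continuous_on_powr' continuous_intros) auto
  ultimately show ?thesis
    unfolding sqrt_beta_density_def by (cases "Gamma (p + 1) = 0") (auto intro!: continuous_intros)
qed

text \<open>
  The two summands of the product rule are the two densities, since \<open>\<Gamma> (p + 1) = p \<Gamma> p\<close> and
  \<open>\<Gamma> (q + 1) = q \<Gamma> q\<close> cancel the factors \<open>p\<close> and \<open>q\<close> that differentiation produces.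
\<close>
lemma has_derivative_boundary:
  assumes "0 < p" "0 < q" "0 < x" "x < 1"
  shows "(boundary p q has_real_derivative sqrt_beta_density p q x - sqrt_beta_density (p - 1) (q + 1) x) (at x)"
proof -
  have pos: "0 < 1 - x\<^sup>2" using assms one_minus_square_pos by simp
  have G: "Gamma (p + 1) = p * Gamma p" "Gamma (q + 1) = q * Gamma q" "Gamma p > 0" "Gamma q > 0"
    using assms nonpos_Ints_nonpos[of p] nonpos_Ints_nonpos[of q] by (auto intro: Gamma_plus1)
  have "((\<lambda>x. (1 - x\<^sup>2) powr p * x powr (2 * q)) has_real_derivative
      (p * (1 - x\<^sup>2) powr (p - 1) * (- 2 * x)) * x powr (2 * q)
        + (1 - x\<^sup>2) powr p * (2 * q * x powr (2 * q - 1))) (at x)"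
    using assms pos by (auto intro!: derivative_eq_intros simp: algebra_simps)
  from DERIV_cdivide[OF this, of "Gamma (p + 1) * Gamma (q + 1)"]
  have "(boundary p q has_real_derivative
      ((p * (1 - x\<^sup>2) powr (p - 1) * (- 2 * x)) * x powr (2 * q)
        + (1 - x\<^sup>2) powr p * (2 * q * x powr (2 * q - 1))) / (Gamma (p + 1) * Gamma (q + 1))) (at x)"
    by (simp add: boundary_def [abs_def])
  also have "((p * (1 - x\<^sup>2) powr (p - 1) * (- 2 * x)) * x powr (2 * q)
        + (1 - x\<^sup>2) powr p * (2 * q * x powr (2 * q - 1))) / (Gamma (p + 1) * Gamma (q + 1))
      = sqrt_beta_density p q x - sqrt_beta_density (p - 1) (q + 1) x"
  proof -
    have "sqrt_beta_density p q x
        = (1 - x\<^sup>2) powr p * (2 * q * x powr (2 * q - 1)) / (Gamma (p + 1) * Gamma (q + 1))"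
      using assms by (simp add: sqrt_beta_density_def G mult_ac)
    moreover have "x powr (2 * (q + 1) - 1) = x * x powr (2 * q)"
      using assms powr_mult_base[of x "2 * q"] by (simp add: algebra_simps)
    then have "sqrt_beta_density (p - 1) (q + 1) x
        = - (p * (1 - x\<^sup>2) powr (p - 1) * (- 2 * x)) * x powr (2 * q) / (Gamma (p + 1) * Gamma (q + 1))"
      using assms by (simp add: sqrt_beta_density_def G)
    ultimately show ?thesis by (simp add: diff_divide_distrib)
  qed
  finally show ?thesis .
qed

text \<open>
  The fundamental theorem of calculus needs the derivative only in the interior and hence also
  covers \<open>q \<le> 1 / 2\<close>, where the density for \<open>(p, q)\<close> is not continuous at \<open>0\<close>. Its integrability is
  then a conclusion: the density for \<open>(p - 1, q + 1)\<close> is continuous on \<open>[0, \<delta>]\<close>.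
\<close>
lemma density_integral_step:
  assumes "0 < p" "0 < q" "0 \<le> \<delta>" "\<delta> < 1"
  shows "(sqrt_beta_density p q has_integral
    boundary p q \<delta> + integral {0..\<delta>} (sqrt_beta_density (p - 1) (q + 1))) {0..\<delta>}"
proof -
  have "((\<lambda>x. sqrt_beta_density p q x - sqrt_beta_density (p - 1) (q + 1) x) has_integral
      boundary p q \<delta> - boundary p q 0) {0..\<delta>}"
    using assms has_derivative_boundary
    by (intro fundamental_theorem_of_calculus_interior continuous_on_boundary)
       (auto simp: has_real_derivative_iff_has_vector_derivative)
  moreover have "(sqrt_beta_density (p - 1) (q + 1) has_integral
      integral {0..\<delta>} (sqrt_beta_density (p - 1) (q + 1))) {0..\<delta>}"
    using assms by (intro integrable_integral integrable_continuous_interval continuous_on_density) auto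
  ultimately have "((\<lambda>x. sqrt_beta_density p q x - sqrt_beta_density (p - 1) (q + 1) x
        + sqrt_beta_density (p - 1) (q + 1) x) has_integral
      boundary p q \<delta> - boundary p q 0 + integral {0..\<delta>} (sqrt_beta_density (p - 1) (q + 1))) {0..\<delta>}"
    by (rule has_integral_add)
  moreover have "boundary p q 0 = 0" by (simp add: boundary_def)
  ultimately show ?thesis by simp
qed

lemma density_integral_expansion:
  assumes "real N < p" "0 < q" "0 \<le> \<delta>" "\<delta> < 1"
  shows "(sqrt_beta_density p q has_integral (\<Sum>j=0..N. boundary (p - real j) (q + real j) \<delta>)
    + integral {0..\<delta>} (sqrt_beta_density (p - real (Suc N)) (q + real (Suc N)))) {0..\<delta>}"
  using assms(1)
proof (induction N)
  case 0
  then show ?case using density_integral_step[of p q \<delta>] assms by simp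
next
  case (Suc N)
  have "integral {0..\<delta>} (sqrt_beta_density (p - real (Suc N)) (q + real (Suc N)))
      = boundary (p - real (Suc N)) (q + real (Suc N)) \<delta>
        + integral {0..\<delta>} (sqrt_beta_density (p - real (Suc (Suc N))) (q + real (Suc (Suc N))))"
    using density_integral_step[of "p - real (Suc N)" "q + real (Suc N)" \<delta>] assms Suc.prems
    by (intro integral_unique) (simp add: algebra_simps)
  with Suc show ?case by (simp add: add.assoc)
qed

section \<open>The two functions as incomplete Beta integrals\<close>

text \<open>
  With \<open>w = 1 - x\<^sup>2\<close>, the substitution \<open>t = x / \<surd>w\<close> has \<open>1 + t\<^sup>2 = 1 / w\<close> and \<open>dt = w\<^bsup>-3/2\<^esup> dx\<close>, so
  that the powers of \<open>w\<close> add up to \<open>- 3 / 2 - (m - 1) / 2 + n / 2 = (n - m - 2) / 2\<close>.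
\<close>
lemma psi_eq_density_integral:
  assumes "1 \<le> m" "0 \<le> \<delta>" "\<delta> < 1"
    and I: "(sqrt_beta_density ((real n - real m - 2) / 2) (real m / 2) has_integral I) {0..\<delta>}"
  shows "psi m n (\<delta> / sqrt (1 - \<delta>\<^sup>2)) = Gamma (real n / 2) * I"
proof -
  define c where "c = 2 / (Gamma (real m / 2) * Gamma ((real n - real m) / 2))"
  define g where "g = (\<lambda>x::real. x / sqrt (1 - x\<^sup>2))"
  define g' where "g' = (\<lambda>x::real. 1 / ((1 - x\<^sup>2) * sqrt (1 - x\<^sup>2)))"
  define f where "f = (\<lambda>t::real. t ^ (m - 1) / (1 + t\<^sup>2) powr (real n / 2))"
  have pos: "0 < 1 - x\<^sup>2" if "0 \<le> x" "x \<le> \<delta>" for x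
    using that assms one_minus_square_pos by simp
  have deriv: "(g has_real_derivative g' x) (at x)" if "0 \<le> x" "x \<le> \<delta>" for x
    unfolding g_def g'_def
    using pos[OF that] by (auto intro!: derivative_eq_intros simp: field_simps power2_eq_square)
  have nonneg: "0 \<le> g x" if "x \<in> {0..\<delta>}" for x
    using that pos[of x] by (simp add: g_def)
  have mono: "g x \<le> g \<delta>" if "x \<in> {0..\<delta>}" for x
    unfolding g_def using that pos[of \<delta>] assms
    by (intro frac_le) (auto simp: power_mono)
  have sub: "((\<lambda>x. g' x *\<^sub>R f (g x)) has_integral integral {g 0..g \<delta>} f) {0..\<delta>}"
  proof (rule has_integral_substitution)
    show "g ` {0..\<delta>} \<subseteq> {0..g \<delta>}" using nonneg mono by auto
    show "continuous_on {0..g \<delta>} f" unfolding f_def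
      by (intro continuous_intros) (auto simp: add_nonneg_eq_0_iff)
    show "\<And>x. x \<in> {0..\<delta>} \<Longrightarrow> (g has_field_derivative g' x) (at x within {0..\<delta>})"
      using deriv by (auto intro: has_field_derivative_at_within)
  qed (use assms mono in auto)
  have integrand: "sqrt_beta_density ((real n - real m - 2) / 2) (real m / 2) x = c * (g' x * f (g x))"
    if "0 < x" "x < \<delta>" for x
  proof -
    define w where "w = 1 - x\<^sup>2"
    have w: "0 < w" using pos[of x] that by (simp add: w_def)
    have "1 + (g x)\<^sup>2 = 1 / w"
      using w by (simp add: g_def w_def field_simps)
    also have "\<dots> = w powr (-1)" using w by (simp add: powr_minus field_simps)
    finally have "(1 + (g x)\<^sup>2) powr (real n / 2) = (w powr (-1)) powr (real n / 2)" by simp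
    also have "\<dots> = w powr (- (real n / 2))" by (simp only: powr_powr) simp
    finally have "(1 + (g x)\<^sup>2) powr (real n / 2) = w powr (- (real n / 2))" .
    moreover have "g x ^ (m - 1) = x powr (real m - 1) * w powr (- ((real m - 1) / 2))"
    proof -
      have "g x ^ (m - 1) = (x * w powr (- 1 / 2)) powr real (m - 1)"
        using w that by (subst powr_realpow) (simp_all add: g_def w_def powr_minus powr_half_sqrt field_simps)
      then show ?thesis using assms that w by (simp add: powr_mult powr_powr of_nat_diff)
    qed
    ultimately have "f (g x) = x powr (real m - 1) * (w powr (- ((real m - 1) / 2)) * w powr (real n / 2))"
      by (simp add: f_def powr_minus_divide)
    moreover have "g' x = w powr (- 3 / 2)"
    proof -
      have "w powr (- 3 / 2) = w powr (- 1 + - 1 / 2)" by simp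
      also have "\<dots> = 1 / (w * sqrt w)"
        using w by (subst powr_add) (simp add: powr_minus powr_half_sqrt field_simps)
      finally show ?thesis by (simp add: g'_def w_def)
    qed
    ultimately have "g' x * f (g x) = x powr (real m - 1)
        * (w powr (- 3 / 2) * (w powr (- ((real m - 1) / 2)) * w powr (real n / 2)))"
      by simp
    also have "w powr (- 3 / 2) * (w powr (- ((real m - 1) / 2)) * w powr (real n / 2))
        = w powr (- 3 / 2 + (- ((real m - 1) / 2) + real n / 2))"
      by (simp only: powr_add)
    also have "- 3 / 2 + (- ((real m - 1) / 2) + real n / 2) = (real n - real m - 2) / 2"
      by (simp add: field_simps)
    finally show ?thesis
      by (simp add: sqrt_beta_density_def c_def w_def field_simps)
  qed
  \<comment> \<open>Only interior points count: for \<open>m = 1\<close> the integrands differ at \<open>0\<close>, as \<open>0 ^ 0 = 1\<close> but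
    \<open>0 powr 0 = 0\<close>.\<close>
  have "(sqrt_beta_density ((real n - real m - 2) / 2) (real m / 2)
      has_integral c * integral {g 0..g \<delta>} f) {0..\<delta>}"
    using has_integral_spike_interior[of "\<lambda>x. c * (g' x * f (g x))" _ 0 \<delta>]
      has_integral_mult_right[OF sub, of c] integrand by auto
  with I have "I = c * integral {g 0..g \<delta>} f" by (rule has_integral_unique)
  then show ?thesis by (simp add: psi_def c_def f_def g_def)
qed

lemma Delta_eq_density_integral:
  assumes "3 \<le> n" "0 \<le> \<delta>" "\<delta> < 1"
  shows "Delta n \<delta> = Gamma (real n / 2)
    * integral {0..\<delta>} (sqrt_beta_density (- 1 / 2) ((real n - 1) / 2))"
proof -
  define c where "c = 2 / (sqrt pi * Gamma ((real n - 1) / 2))"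
  have "sqrt_beta_density (- 1 / 2) ((real n - 1) / 2) x = c * (x ^ (n - 2) / sqrt (1 - x\<^sup>2))"
    if "x \<in> {0..\<delta>}" for x
  proof -
    have "0 < 1 - x\<^sup>2" using that assms one_minus_square_pos by simp
    moreover have "x powr (2 * ((real n - 1) / 2) - 1) = x ^ (n - 2)"
      using that assms powr_realpow'[of x "n - 2"] by (simp add: of_nat_diff diff_divide_distrib)
    ultimately show ?thesis
      by (simp add: sqrt_beta_density_def c_def Gamma_one_half_real powr_minus powr_half_sqrt field_simps)
  qed
  then have "integral {0..\<delta>} (sqrt_beta_density (- 1 / 2) ((real n - 1) / 2))
      = c * integral {0..\<delta>} (\<lambda>x. x ^ (n - 2) / sqrt (1 - x\<^sup>2))"
    by (subst integral_mult_right [symmetric], intro integral_cong) auto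
  then show ?thesis by (simp add: Delta_def c_def)
qed

section \<open>Bounds for the remainder\<close>

lemma Delta_nonneg:
  assumes "2 \<le> n" "0 \<le> \<delta>" "\<delta> < 1"
  shows "0 \<le> Delta n \<delta>"
proof -
  have pos: "0 < 1 - t\<^sup>2" if "t \<in> {0..\<delta>}" for t
    using that assms one_minus_square_pos by simp
  then have "continuous_on {0..\<delta>} (\<lambda>t. t ^ (n - 2) / sqrt (1 - t\<^sup>2))"
    by (intro continuous_intros) fastforce
  then have "0 \<le> integral {0..\<delta>} (\<lambda>t. t ^ (n - 2) / sqrt (1 - t\<^sup>2))"
    using pos by (intro integral_nonneg integrable_continuous_interval) (auto intro!: divide_nonneg_nonneg simp: less_imp_le)
  then show ?thesis using assms by (simp add: Delta_def)
qed

text \<open>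
  Substituting \<open>v = (t / \<delta>)\<^sup>2\<close> turns the integral into \<open>\<delta>\<^bsup>n-1\<^esup> / 2\<close> times an integral over \<open>[0, 1]\<close>
  that lies below \<open>B ((n - 1) / 2, 1 / 2)\<close>. Scaling by \<open>\<delta>\<close> keeps the integrand continuous on
  \<open>[0, 1]\<close>, so the singularity at \<open>1\<close> enters only through the known Beta integral.
\<close>
lemma Delta_le_power:
  assumes "4 \<le> n" "0 < \<delta>" "\<delta> < 1"
  shows "Delta n \<delta> \<le> \<delta> ^ (n - 1)"
proof -
  define a where "a = (real n - 1) / 2"
  have a: "1 < a" using assms by (simp add: a_def)
  define f where "f = (\<lambda>v::real. v powr (a - 1) * (1 - \<delta>\<^sup>2 * v) powr (1 / 2 - 1))"
  have \<delta>2: "0 < \<delta>\<^sup>2" "\<delta>\<^sup>2 < 1" using assms one_minus_square_pos[of \<delta>] by simp_all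
  have pos: "0 < 1 - \<delta>\<^sup>2 * v" if "0 \<le> v" "v \<le> 1" for v
    using mult_left_le[of v "\<delta>\<^sup>2"] that \<delta>2 by linarith
  have cont: "continuous_on {0..1} f" unfolding f_def
    using a pos by (intro continuous_intros continuous_on_powr') force+
  have "((\<lambda>t. (2 * t / \<delta>\<^sup>2) *\<^sub>R f ((t / \<delta>)\<^sup>2)) has_integral integral {(0 / \<delta>)\<^sup>2..(\<delta> / \<delta>)\<^sup>2} f) {0..\<delta>}"
  proof (rule has_integral_substitution[OF _ _ _ cont])
    show "(\<lambda>t. (t / \<delta>)\<^sup>2) ` {0..\<delta>} \<subseteq> {0..1}"
      using assms by (auto simp: power_le_one)
    show "\<And>t. t \<in> {0..\<delta>} \<Longrightarrow> ((\<lambda>t. (t / \<delta>)\<^sup>2) has_field_derivative 2 * t / \<delta>\<^sup>2) (at t within {0..\<delta>})"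
      using assms by (auto intro!: derivative_eq_intros simp: power2_eq_square)
  qed (use assms in auto)
  then have sub: "((\<lambda>t. (2 * t / \<delta>\<^sup>2) * f ((t / \<delta>)\<^sup>2)) has_integral integral {0..1} f) {0..\<delta>}"
    using assms by simp
  have integrand: "t ^ (n - 2) / sqrt (1 - t\<^sup>2) = \<delta> ^ (n - 1) / 2 * ((2 * t / \<delta>\<^sup>2) * f ((t / \<delta>)\<^sup>2))"
    if "t \<in> {0..\<delta>}" for t
  proof (cases "t = 0")
    case False
    have pt: "0 < 1 - t\<^sup>2" using that assms one_minus_square_pos by simp
    have "((t / \<delta>)\<^sup>2) powr (a - 1) = (t / \<delta>) powr (2 * (a - 1))"
      using that assms by (simp add: powr_powr flip: powr_numeral)
    also have "2 * (a - 1) = real (n - 3)" using assms by (simp add: a_def of_nat_diff diff_divide_distrib)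
    also have "(t / \<delta>) powr \<dots> = (t / \<delta>) ^ (n - 3)"
      using that assms False by (intro powr_realpow) auto
    finally have "f ((t / \<delta>)\<^sup>2) = (t / \<delta>) ^ (n - 3) / sqrt (1 - t\<^sup>2)"
      using pt assms by (simp add: f_def powr_minus powr_half_sqrt power_divide field_simps)
    moreover obtain d where "n = 3 + d" using assms le_Suc_ex[of 3 n] by auto
    ultimately show ?thesis
      using assms by (simp add: power_divide power_add power2_eq_square field_simps eval_nat_numeral)
  qed (use assms in auto)
  have "integral {0..\<delta>} (\<lambda>t. t ^ (n - 2) / sqrt (1 - t\<^sup>2))
      = integral {0..\<delta>} (\<lambda>t. \<delta> ^ (n - 1) / 2 * ((2 * t / \<delta>\<^sup>2) * f ((t / \<delta>)\<^sup>2)))"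
    using integrand by (intro integral_cong) auto
  also have "\<dots> = \<delta> ^ (n - 1) / 2 * integral {0..1} f"
    using has_integral_mult_right[OF sub] by (rule integral_unique)
  also have "\<dots> \<le> \<delta> ^ (n - 1) / 2 * Beta a (1 / 2)"
  proof (intro mult_left_mono)
    \<comment> \<open>The comparison fails at \<open>v = 1\<close>, where the Beta integrand is \<open>0 powr (- 1 / 2) = 0\<close>.\<close>
    have "(f has_integral integral {0..1} f) {0<..<1}"
      using integrable_integral[OF integrable_continuous_interval[OF cont]]
      by (simp add: has_integral_Icc_iff_Ioo)
    moreover have "((\<lambda>v. v powr (a - 1) * (1 - v) powr (1 / 2 - 1)) has_integral Beta a (1 / 2)) {0<..<1}"
      using has_integral_Beta_real[of a "1 / 2"] a by (simp add: has_integral_Icc_iff_Ioo)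
    moreover have "f v \<le> v powr (a - 1) * (1 - v) powr (1 / 2 - 1)" if "v \<in> {0<..<1}" for v
      unfolding f_def using that \<delta>2 mult_right_mono[of "\<delta>\<^sup>2" 1 v]
      by (intro mult_left_mono powr_mono2') auto
    ultimately show "integral {0..1} f \<le> Beta a (1 / 2)"
      by (rule has_integral_le)
  qed (use assms in auto)
  finally have "integral {0..\<delta>} (\<lambda>t. t ^ (n - 2) / sqrt (1 - t\<^sup>2)) \<le> \<delta> ^ (n - 1) / 2 * Beta a (1 / 2)" .
  then have "Delta n \<delta> \<le> 2 / sqrt pi * (Gamma (real n / 2) / Gamma a) * (\<delta> ^ (n - 1) / 2 * Beta a (1 / 2))"
    unfolding Delta_def a_def using assms by (intro mult_left_mono) auto
  also have "\<dots> = \<delta> ^ (n - 1)"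
  proof -
    have "real n / 2 = a + 1 / 2" by (simp add: a_def field_simps)
    moreover have "Gamma a > 0" "Gamma (a + 1 / 2) > 0" using a by simp_all
    ultimately show ?thesis unfolding Beta_def by (simp only: Gamma_one_half_real) simp
  qed
  finally show ?thesis .
qed

theorem theorem3p3:
  fixes m n :: nat and k l \<nu> :: real
  assumes "m \<ge> 1" and "n \<ge> m + 3" and "odd (n - m)"
    and "k = (real n - real m - 2) / 2"
    and "l = real m / 2"
    and "\<nu> = k - 1 / 2"
  shows "\<forall>\<delta>::real. 0 \<le> \<delta> \<and> \<delta> < 1 \<longrightarrow>
      psi m n (\<delta> / sqrt (1 - \<delta>\<^sup>2)) =
        (\<Sum>j = 0..nat \<lfloor>\<nu>\<rfloor>.
           Gamma (k + l + 1) / (Gamma (k - real j + 1) * Gamma (l + real j + 1)) *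
           (1 - \<delta>\<^sup>2) powr (k - real j) * \<delta> powr (2 * (l + real j)))
        + Delta n \<delta>
      \<and> 0 \<le> Delta n \<delta> \<and> Delta n \<delta> \<le> \<delta> ^ (n - 1)"
proof (intro allI impI conjI)
  fix \<delta> :: real
  assume "0 \<le> \<delta> \<and> \<delta> < 1"
  then have \<delta>: "0 \<le> \<delta>" "\<delta> < 1" by auto
  show "0 \<le> Delta n \<delta>" using Delta_nonneg \<delta> assms by simp
  show "Delta n \<delta> \<le> \<delta> ^ (n - 1)"
    using Delta_le_power[of n \<delta>] \<delta> assms by (cases "\<delta> = 0") (auto simp: Delta_def)
  define N where "N = (n - m - 3) div 2"
  obtain d where "n - m = 2 * d + 1" using assms(3) by (elim oddE)
  then have N: "n = m + 2 * N + 3" using assms(2) by (auto simp: N_def)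
  then have \<nu>: "\<nu> = real N" and k: "k = real N + 1 / 2"
    using assms(4,6) by (simp_all add: field_simps)
  have kl: "k + l + 1 = real n / 2" using assms(4,5) by (simp add: field_simps)
  have "(sqrt_beta_density k l has_integral (\<Sum>j=0..N. boundary (k - real j) (l + real j) \<delta>)
      + integral {0..\<delta>} (sqrt_beta_density (k - real (Suc N)) (l + real (Suc N)))) {0..\<delta>}"
    using k assms(1,5) \<delta> by (intro density_integral_expansion) auto
  moreover have "k - real (Suc N) = - 1 / 2" "l + real (Suc N) = (real n - 1) / 2"
    using k N assms(5) by (simp_all add: field_simps)
  ultimately have "(sqrt_beta_density k l has_integral (\<Sum>j=0..N. boundary (k - real j) (l + real j) \<delta>)
      + integral {0..\<delta>} (sqrt_beta_density (- 1 / 2) ((real n - 1) / 2))) {0..\<delta>}" by (simp only:)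
  from psi_eq_density_integral[OF assms(1) \<delta> this[unfolded assms(4,5)], folded assms(4,5)]
  have "psi m n (\<delta> / sqrt (1 - \<delta>\<^sup>2))
      = (\<Sum>j=0..N. Gamma (k + l + 1) * boundary (k - real j) (l + real j) \<delta>) + Delta n \<delta>"
    using Delta_eq_density_integral[of n \<delta>] assms(2) \<delta>
    by (simp add: kl sum_distrib_left distrib_left)
  then show "psi m n (\<delta> / sqrt (1 - \<delta>\<^sup>2)) =
        (\<Sum>j = 0..nat \<lfloor>\<nu>\<rfloor>.
           Gamma (k + l + 1) / (Gamma (k - real j + 1) * Gamma (l + real j + 1)) *
           (1 - \<delta>\<^sup>2) powr (k - real j) * \<delta> powr (2 * (l + real j)))
        + Delta n \<delta>"
    by (simp add: \<nu> boundary_def mult.assoc)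
qed

end
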